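(* Let $X$ be a compact metric space and let $F:X\to 2^X$ be an upper semi-continuous set-valued map with $F(X)=X$. If the shift map $\sigma:\underleftarrow{\lim} F\to\underleftarrow{\lim} F$ is Devaney chaotic, then $F$ is Devaney chaotic.
   Context: $\mathbb{N}=\{0,1,2,\dots\}$, $\mathbb{Z}^+=\{1,2,3,\dots\}$. $d$ is the metric of $X$, with the diameter of $X$ assumed equal to $1$, and $B(x,\varepsilon)=\{y: d(x,y)<\varepsilon\}$. $2^X$ is the set of nonempty closed subsets of $X$. $F:X\to 2^X$ is upper semi-continuous if for every $x\in X$ and every open $V\subset X$ containing $F(x)$ there is an open $U\subset X$ containing $x$ with $F(t)\subset V$ for all $t\in U$. $F(X)=\bigcup_{x\in X}F(x)$. The inverse limit space is $\underleftarrow{\lim} F=\{(x_0,x_1,\dots)\in X^{\mathbb{N}}: x_i\in F(x_{i+1})\ \forall i\ge 0\}$, a subspace of the product $X^{\mathbb{N}}$, with metric $\rho(x,y)=\sum_{i=0}^\infty d(x_i,y_i)/2^i$, and $\sigma(x_0,x_1,\dots)=(x_1,x_2,\dots)$. Single-valued notions. A continuous map $g:Y\to Y$ on a compact metric space $(Y,\rho)$ is Devaney chaotic if: (1) it is transitive: for any nonempty open $U,V\subset Y$ there is $n\in\mathbb{Z}^+$ with $g^n(U)\cap V\neq\emptyset$; (2) the set of points $z$ with $g^n(z)=z$ for some $n\in\mathbb{Z}^+$ is dense in $Y$; (3) it is sensitive: there is $\delta>0$ such that for any $x\in Y$ and $\varepsilon>0$ there are $y\in Y$ with $\rho(x,y)<\varepsilon$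 and $n\in\mathbb{Z}^+$ with $\rho(g^n(x),g^n(y))>\delta$. Set-valued notions. An orbit of $x\in X$ for $F$ is a sequence $(x_i)_{i=0}^\infty$ with $x_0=x$ and $x_{i+1}\in F(x_i)$ for all $i\ge0$; it is periodic if there is $m\in\mathbb{Z}^+$ with $x_i=x_{i+m}$ for all $i\ge0$. $P(F)$ is the set of points having at least one periodic orbit. $F$ is Devaney chaotic if: (1) $F$ is transitive: for any nonempty open $U,V\subset X$ there is $n\in\mathbb{Z}^+$ and $x_0\in U$ with an orbit $(x_i)$ satisfying $x_n\in V$; (2) $\overline{P(F)}=X$; (3) $F$ is sensitive: there is $\delta>0$ such that for any $\varepsilon>0$, any $x\in X$ and any orbit $(x_i)_{i=0}^\infty$ of $x$, there are $y\in B(x,\varepsilon)$ with an orbit $(y_i)_{i=0}^\infty$ and $n\in\mathbb{Z}^+$ satisfying $d(x_n,y_n)>\delta$. *)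

theory Defs
  imports "HOL-Analysis.Analysis"
begin

text \<open>
  Single-valued dynamics on a metric space \<open>(M, d)\<close> given by a carrier set. The map \<open>g\<close> is a total
  HOL function; only its values on \<open>M\<close> matter, and it is meant to be a continuous self-map of \<open>M\<close>.
\<close>

context Metric_space
begin

definition transitive_map :: "('a \<Rightarrow> 'a) \<Rightarrow> bool" where
  "transitive_map g \<longleftrightarrow>
     (\<forall>U V. openin mtopology U \<and> U \<noteq> {} \<and> openin mtopology V \<and> V \<noteq> {} \<longrightarrow>
        (\<exists>n\<ge>1. (g ^^ n) ` U \<inter> V \<noteq> {}))"

definition periodic_points :: "('a \<Rightarrow> 'a) \<Rightarrow> 'a set" where
  "periodic_points g = {z \<in> M. \<exists>n\<ge>1. (g ^^ n) z = z}"

definition sensitive_map :: "('a \<Rightarrow> 'a) \<Rightarrow> bool" where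
  "sensitive_map g \<longleftrightarrow>
     (\<exists>\<delta>>0. \<forall>x\<in>M. \<forall>\<epsilon>>0. \<exists>y\<in>M. d x y < \<epsilon> \<and> (\<exists>n\<ge>1. d ((g ^^ n) x) ((g ^^ n) y) > \<delta>))"

definition devaney_chaotic_map :: "('a \<Rightarrow> 'a) \<Rightarrow> bool" where
  "devaney_chaotic_map g \<longleftrightarrow>
     transitive_map g \<and> mtopology closure_of periodic_points g = M \<and> sensitive_map g"

end

text \<open>
  Set-valued dynamics. The space \<open>X\<close> is a whole type of class \<^class>\<open>metric_space\<close>; its compactness
  is assumed where it is needed.
\<close>

definition closed_valued :: "('a::metric_space \<Rightarrow> 'a set) \<Rightarrow> bool" where
  "closed_valued F \<longleftrightarrow> (\<forall>x. closed (F x) \<and> F x \<noteq> {})"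

definition upper_semicontinuous :: "('a::metric_space \<Rightarrow> 'a set) \<Rightarrow> bool" where
  "upper_semicontinuous F \<longleftrightarrow>
     (\<forall>x V. open V \<and> F x \<subseteq> V \<longrightarrow> (\<exists>U. open U \<and> x \<in> U \<and> (\<forall>t\<in>U. F t \<subseteq> V)))"

definition is_orbit :: "('a \<Rightarrow> 'a set) \<Rightarrow> 'a \<Rightarrow> (nat \<Rightarrow> 'a) \<Rightarrow> bool" where
  "is_orbit F x xs \<longleftrightarrow> xs 0 = x \<and> (\<forall>i. xs (Suc i) \<in> F (xs i))"

definition periodic_seq :: "(nat \<Rightarrow> 'a) \<Rightarrow> bool" where
  "periodic_seq xs \<longleftrightarrow> (\<exists>m\<ge>1. \<forall>i. xs i = xs (i + m))"

definition sv_periodic_points :: "('a \<Rightarrow> 'a set) \<Rightarrow> 'a set" where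
  "sv_periodic_points F = {x. \<exists>xs. is_orbit F x xs \<and> periodic_seq xs}"

definition sv_transitive :: "('a::metric_space \<Rightarrow> 'a set) \<Rightarrow> bool" where
  "sv_transitive F \<longleftrightarrow>
     (\<forall>U V. open U \<and> U \<noteq> {} \<and> open V \<and> V \<noteq> {} \<longrightarrow>
        (\<exists>n\<ge>1. \<exists>x\<in>U. \<exists>xs. is_orbit F x xs \<and> xs n \<in> V))"

definition sv_sensitive :: "('a::metric_space \<Rightarrow> 'a set) \<Rightarrow> bool" where
  "sv_sensitive F \<longleftrightarrow>
     (\<exists>\<delta>>0. \<forall>\<epsilon>>0. \<forall>x xs. is_orbit F x xs \<longrightarrow>
        (\<exists>y\<in>ball x \<epsilon>. \<exists>ys. is_orbit F y ys \<and> (\<exists>n\<ge>1. dist (xs n) (ys n) > \<delta>)))"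

definition sv_devaney_chaotic :: "('a::metric_space \<Rightarrow> 'a set) \<Rightarrow> bool" where
  "sv_devaney_chaotic F \<longleftrightarrow>
     sv_transitive F \<and> closure (sv_periodic_points F) = UNIV \<and> sv_sensitive F"

definition inverse_limit :: "('a \<Rightarrow> 'a set) \<Rightarrow> (nat \<Rightarrow> 'a) set" where
  "inverse_limit F = {x. \<forall>i. x i \<in> F (x (Suc i))}"

definition shift :: "(nat \<Rightarrow> 'a) \<Rightarrow> nat \<Rightarrow> 'a" where
  "shift x = (\<lambda>i. x (Suc i))"

text \<open>
  This is not the metric that the library's type class instance puts on \<open>nat \<Rightarrow> 'a\<close>. The series
  converges when the space is bounded, which the next two lemmas use.
\<close>

definition seq_dist :: "(nat \<Rightarrow> 'a::metric_space) \<Rightarrow> (nat \<Rightarrow> 'a) \<Rightarrow> real" where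
  "seq_dist x y = (\<Sum>i. dist (x i) (y i) / 2 ^ i)"

lemma summable_seq_dist:
  fixes x y :: "nat \<Rightarrow> 'a::metric_space"
  assumes "bounded (UNIV :: 'a set)"
  shows "summable (\<lambda>i. dist (x i) (y i) / 2 ^ i)"
proof -
  obtain B where B: "\<And>a b::'a. dist a b \<le> B"
    using assms by (auto simp: bounded_two_points)
  have "summable (\<lambda>i. B * (1 / 2) ^ i :: real)"
    by (intro summable_mult summable_geometric) simp
  moreover have "norm (dist (x i) (y i) / 2 ^ i) \<le> B * (1 / 2) ^ i" for i
    using divide_right_mono[OF B, of "2 ^ i" "x i" "y i"] by (simp add: power_one_over)
  ultimately show ?thesis
    by (rule summable_comparison_test'[where N = 0])
qed

lemma Metric_space_seq_dist:
  fixes S :: "(nat \<Rightarrow> 'a::metric_space) set"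
  assumes "compact (UNIV :: 'a set)"
  shows "Metric_space S seq_dist"
proof -
  note sm = summable_seq_dist[OF compact_imp_bounded[OF assms]]
  show ?thesis
  proof
    fix x y z :: "nat \<Rightarrow> 'a"
    show "0 \<le> seq_dist x y"
      unfolding seq_dist_def by (intro suminf_nonneg sm) simp
    show "seq_dist x y = seq_dist y x"
      by (simp add: seq_dist_def dist_commute)
    show "seq_dist x y = 0 \<longleftrightarrow> x = y"
      unfolding seq_dist_def by (subst suminf_eq_zero_iff[OF sm]) (simp_all add: fun_eq_iff)
    have "seq_dist x z \<le> (\<Sum>i. dist (x i) (y i) / 2 ^ i + dist (y i) (z i) / 2 ^ i)"
      unfolding seq_dist_def
    proof (intro suminf_le sm summable_add)
      fix i
      show "dist (x i) (z i) / 2 ^ i \<le> dist (x i) (y i) / 2 ^ i + dist (y i) (z i) / 2 ^ i"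
        using divide_right_mono[OF dist_triangle, of "2 ^ i" "x i" "z i" "y i"]
        by (simp only: add_divide_distrib) simp
    qed
    also have "\<dots> = seq_dist x y + seq_dist y z"
      unfolding seq_dist_def by (intro suminf_add[symmetric] sm)
    finally show "seq_dist x z \<le> seq_dist x y + seq_dist y z" .
  qed
qed

end

theory Submission
  imports Defs
begin

text \<open>
  Points of the inverse limit are orbits of \<open>F\<close> read backwards, so the coordinates \<open>0, \<dots>, n\<close>
  of a point, reversed, begin an orbit of \<open>F\<close>, which can be continued because \<open>F\<close> has nonempty values.
  Reversing a point of the inverse limit as a whole is possible when the point is periodic: if it has
  period \<open>m\<close>, stepping by \<open>m - 1\<close> amounts to stepping by \<open>-1\<close> modulo \<open>m\<close>. Since every point
  of \<open>X\<close> is the zeroth coordinate of some point of the inverse limit and the cylinder sets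
  \<open>{z. z k \<in> U}\<close> are open there, transitivity and density of periodic points pass from the
  shift to \<open>F\<close>.

  For sensitivity the direction of time is the difficulty: sensitivity of the shift separates points
  in the past of \<open>F\<close>, whereas sensitivity of \<open>F\<close> asks for separation in the future. On periodic
  points there is no difference between past and future. Given an orbit \<open>x\<close> of \<open>F\<close>, two
  periodic points \<open>z\<close>, \<open>w\<close> of the shift are chosen with \<open>z 0\<close> and \<open>w 0\<close>
  close to \<open>x 0\<close> and \<open>z\<close>, \<open>w\<close> far apart at some coordinate (\<open>w\<close> can be
  taken periodic because both conditions on it are open). With respect to a common period, both are
  reversed to orbits of \<open>F\<close> that are far apart at some positive time, so at that time at least
  one of them is far from \<open>x\<close>.
\<close>

section \<open>The inverse limit\<close>

lemma inverse_limit_through_point: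
  assumes "(\<Union>x. F x) = UNIV"
  obtains z where "z \<in> inverse_limit F" and "z 0 = a"
proof -
  have "\<forall>x. \<exists>y. x \<in> F y"
    using assms by blast
  then obtain p where p: "\<And>x. x \<in> F (p x)"
    by metis
  have "(\<lambda>i. (p ^^ i) a) \<in> inverse_limit F"
    using p by (simp add: inverse_limit_def)
  then show thesis
    by (rule that) simp
qed

lemma shift_funpow: "(shift ^^ n) z = (\<lambda>i. z (i + n))"
  by (induction n) (simp_all add: shift_def)

lemma dist_coordinate_le_seq_dist:
  fixes x y :: "nat \<Rightarrow> 'a::metric_space"
  assumes "compact (UNIV :: 'a set)"
  shows "dist (x k) (y k) \<le> 2 ^ k * seq_dist x y"
proof -
  note sm = summable_seq_dist[OF compact_imp_bounded[OF assms], of x y]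
  have "(\<Sum>i\<in>{k}. dist (x i) (y i) / 2 ^ i) \<le> seq_dist x y"
    unfolding seq_dist_def by (rule sum_le_suminf[OF sm]) auto
  then show ?thesis
    by (simp add: field_simps)
qed

text \<open>The weights \<open>1 / 2 ^ i\<close> add up to \<open>2\<close>.\<close>

lemma seq_dist_gt_imp_coordinate_gt:
  fixes x y :: "nat \<Rightarrow> 'a::metric_space"
  assumes "compact (UNIV :: 'a set)" and "seq_dist x y > \<delta>"
  obtains k where "dist (x k) (y k) > \<delta> / 2"
proof (rule ccontr)
  assume "\<not> thesis"
  with that have le: "dist (x k) (y k) \<le> \<delta> / 2" for k
    by (meson not_less)
  note sm = summable_seq_dist[OF compact_imp_bounded[OF assms(1)], of x y]
  have geo: "(\<lambda>i. (\<delta> / 2) * (1 / 2) ^ i) sums ((\<delta> / 2) * (1 / (1 - 1 / 2)))"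
    by (intro sums_mult geometric_sums) simp
  have "seq_dist x y \<le> (\<Sum>i. (\<delta> / 2) * (1 / 2) ^ i)"
    unfolding seq_dist_def
  proof (rule suminf_le[OF _ sm sums_summable[OF geo]])
    fix i
    show "dist (x i) (y i) / 2 ^ i \<le> (\<delta> / 2) * (1 / 2) ^ i"
      using divide_right_mono[OF le, of "2 ^ i" i] by (simp add: power_one_over)
  qed
  also have "\<dots> = \<delta>"
    using sums_unique[OF geo] by simp
  finally show False
    using assms(2) by simp
qed

lemma openin_cylinder:
  fixes S :: "(nat \<Rightarrow> 'a::metric_space) set"
  assumes "compact (UNIV :: 'a set)" and "open U"
  shows "openin (Metric_space.mtopology S seq_dist) {z \<in> S. z k \<in> U}"
proof -
  interpret Metric_space S seq_dist
    by (rule Metric_space_seq_dist[OF assms(1)])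
  show ?thesis
    unfolding openin_mtopology
  proof (intro conjI allI impI)
    fix z assume "z \<in> {z \<in> S. z k \<in> U}"
    then obtain e where e: "e > 0" "ball (z k) e \<subseteq> U"
      using \<open>open U\<close> openE by blast
    have "y k \<in> U" if "seq_dist z y < e / 2 ^ k" for y
    proof -
      have "dist (z k) (y k) < e"
        using that dist_coordinate_le_seq_dist[OF assms(1), of z k y] by (simp add: field_simps)
      then show ?thesis
        using e by auto
    qed
    then have "mball z (e / 2 ^ k) \<subseteq> {z \<in> S. z k \<in> U}"
      by auto
    with e(1) show "\<exists>r>0. mball z r \<subseteq> {z \<in> S. z k \<in> U}"
      by (meson divide_pos_pos zero_less_numeral zero_less_power)
  qed auto
qed

section \<open>Turning points of the inverse limit into orbits\<close>

text \<open>
  From the zeroth coordinate on, the orbit is continued by an arbitrary choice of successors.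
\<close>

lemma orbit_from_inverse_limit:
  assumes "\<And>x. F x \<noteq> {}" and "z \<in> inverse_limit F"
  obtains xs where "is_orbit F (z n) xs" and "xs n = z 0"
proof -
  define s where "s x = (SOME y. y \<in> F x)" for x
  have s: "s x \<in> F x" for x
    unfolding s_def using assms(1) by (simp add: some_in_eq)
  define xs where "xs i = (if i \<le> n then z (n - i) else (s ^^ (i - n)) (z 0))" for i
  have "xs (Suc i) \<in> F (xs i)" for i
  proof (cases "i < n")
    case True
    then have "n - i = Suc (n - Suc i)"
      by simp
    with True assms(2) show ?thesis
      by (simp add: xs_def inverse_limit_def)
  next
    case False
    then show ?thesis
      using s by (auto simp: xs_def Suc_diff_le)
  qed
  then have "is_orbit F (z n) xs"
    by (simp add: is_orbit_def xs_def)
  then show thesis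
    by (rule that) (simp add: xs_def)
qed

lemma add_mult_period:
  fixes z :: "nat \<Rightarrow> 'a"
  assumes "\<And>i. z (i + m) = z i"
  shows "z (i + m * k) = z i"
proof (induction k)
  case (Suc k)
  then show ?case
    using assms[of "i + m * k"] by (simp add: algebra_simps)
qed simp

lemma is_orbit_reverse_periodic:
  assumes z: "z \<in> inverse_limit F" and per: "\<And>i. z (i + m) = z i" and "m \<ge> 1"
  shows "is_orbit F (z 0) (\<lambda>i. z ((m - 1) * i))"
proof -
  have "z ((m - 1) * Suc i) \<in> F (z ((m - 1) * i))" for i
  proof -
    have "z ((m - 1) * Suc i) \<in> F (z (Suc ((m - 1) * Suc i)))"
      using z by (simp add: inverse_limit_def)
    also have "Suc ((m - 1) * Suc i) = (m - 1) * i + m"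
      using \<open>m \<ge> 1\<close> by simp
    finally show ?thesis
      by (simp only: per)
  qed
  then show ?thesis
    by (simp add: is_orbit_def)
qed

lemma periodic_point_in_sv_periodic_points:
  assumes "z \<in> inverse_limit F" and per: "\<And>i. z (i + m) = z i" and "m \<ge> 1"
  shows "z 0 \<in> sv_periodic_points F"
proof -
  have "z ((m - 1) * i) = z ((m - 1) * (i + m))" for i
    using add_mult_period[of z m "(m - 1) * i" "m - 1", OF per]
    by (simp only: distrib_left mult.commute[of m])
  then have "periodic_seq (\<lambda>i. z ((m - 1) * i))"
    unfolding periodic_seq_def using \<open>m \<ge> 1\<close> by blast
  then show ?thesis
    unfolding sv_periodic_points_def using is_orbit_reverse_periodic[OF assms] by blast
qed

text \<open>
  Modulo a period \<open>m\<close>, reversing twice is the identity, so the reversed orbit is at \<open>z k\<close> at time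
  \<open>(m - 1) * k\<close>. For \<open>m \<ge> 2\<close> and \<open>k \<ge> 1\<close> this time is positive, and
  it does not depend on \<open>z\<close>.
\<close>

lemma reverse_periodic_at:
  fixes z :: "nat \<Rightarrow> 'a"
  assumes "\<And>i. z (i + m) = z i" and "m \<ge> 2"
  shows "z ((m - 1) * ((m - 1) * k)) = z k"
proof -
  obtain j where "m = j + 2"
    using assms(2) by (metis add.commute le_Suc_ex)
  then have "(m - 1) * ((m - 1) * k) = k + m * (j * k)"
    by (simp add: algebra_simps)
  then show ?thesis
    by (simp only: add_mult_period[of z m, OF assms(1)])
qed

section \<open>Chaos passes from the shift to the set-valued map\<close>

lemma sv_transitive_if_shift_transitive:
  fixes F :: "'a::metric_space \<Rightarrow> 'a set"
  assumes cpt: "compact (UNIV :: 'a set)" and ne: "\<And>x. F x \<noteq> {}"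
    and surj: "(\<Union>x. F x) = UNIV"
    and trans: "Metric_space.transitive_map (inverse_limit F) seq_dist shift"
  shows "sv_transitive F"
  unfolding sv_transitive_def
proof (intro allI impI, elim conjE)
  fix U V :: "'a set"
  assume UV: "open U" "U \<noteq> {}" "open V" "V \<noteq> {}"
  interpret Metric_space "inverse_limit F" seq_dist
    by (rule Metric_space_seq_dist[OF cpt])
  have cyl_ne: "{z \<in> inverse_limit F. z 0 \<in> A} \<noteq> {}" if A: "A \<noteq> {}" for A
  proof -
    obtain a where "a \<in> A"
      using A by blast
    then show ?thesis
      using inverse_limit_through_point[OF surj, of a] by blast
  qed
  \<comment> \<open>The shift runs backwards along orbits of \<open>F\<close>, so it has to lead from \<open>V\<close> to \<open>U\<close>.\<close>
  obtain n where "n \<ge> 1" and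
    "(shift ^^ n) ` {z \<in> inverse_limit F. z 0 \<in> V} \<inter> {z \<in> inverse_limit F. z 0 \<in> U} \<noteq> {}"
    using trans openin_cylinder[OF cpt UV(1), of "inverse_limit F" 0] cyl_ne[OF UV(2)]
      openin_cylinder[OF cpt UV(3), of "inverse_limit F" 0] cyl_ne[OF UV(4)]
    unfolding transitive_map_def by meson
  then obtain z where z: "z \<in> inverse_limit F" "z 0 \<in> V" "z n \<in> U"
    by (auto simp: shift_funpow)
  obtain xs where "is_orbit F (z n) xs" "xs n = z 0"
    using orbit_from_inverse_limit[OF ne z(1)] by blast
  with z \<open>n \<ge> 1\<close> show "\<exists>n\<ge>1. \<exists>x\<in>U. \<exists>xs. is_orbit F x xs \<and> xs n \<in> V"
    by metis
qed

lemma periodic_point_in_open: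
  fixes F :: "'a::metric_space \<Rightarrow> 'a set"
  assumes cpt: "compact (UNIV :: 'a set)"
    and dense: "Metric_space.mtopology (inverse_limit F) seq_dist closure_of
      Metric_space.periodic_points (inverse_limit F) shift = inverse_limit F"
    and W: "openin (Metric_space.mtopology (inverse_limit F) seq_dist) W" "W \<noteq> {}"
  obtains z m where "z \<in> W" and "z \<in> inverse_limit F" and "m \<ge> 1" and "\<And>i. z (i + m) = z i"
proof -
  interpret Metric_space "inverse_limit F" seq_dist
    by (rule Metric_space_seq_dist[OF cpt])
  have "periodic_points shift \<inter> W \<noteq> {}"
    using dense W dense_intersects_open[of mtopology "periodic_points shift"] by auto
  then obtain z m where z: "z \<in> W" "z \<in> inverse_limit F" "m \<ge> 1" "(shift ^^ m) z = z"
    by (auto simp: periodic_points_def)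
  have "z (i + m) = z i" for i
    using fun_cong[OF z(4), of i] by (simp add: shift_funpow)
  with z(1-3) show thesis
    by (rule that)
qed

lemma closure_sv_periodic_points_if_shift_periodic_dense:
  fixes F :: "'a::metric_space \<Rightarrow> 'a set"
  assumes cpt: "compact (UNIV :: 'a set)" and surj: "(\<Union>x. F x) = UNIV"
    and dense: "Metric_space.mtopology (inverse_limit F) seq_dist closure_of
      Metric_space.periodic_points (inverse_limit F) shift = inverse_limit F"
  shows "closure (sv_periodic_points F) = UNIV"
proof -
  have "\<exists>y\<in>sv_periodic_points F. dist y a < e" if "e > 0" for a :: 'a and e
  proof -
    obtain z where "z \<in> inverse_limit F" "z 0 = a"
      using inverse_limit_through_point[OF surj] .
    with \<open>e > 0\<close> have "{z \<in> inverse_limit F. z 0 \<in> ball a e} \<noteq> {}"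
      by auto
    then obtain p m where p: "p \<in> {z \<in> inverse_limit F. z 0 \<in> ball a e}"
      "p \<in> inverse_limit F" "m \<ge> 1" "\<And>i. p (i + m) = p i"
      using periodic_point_in_open[OF cpt dense openin_cylinder[OF cpt open_ball]] by blast
    have "p 0 \<in> sv_periodic_points F"
      using periodic_point_in_sv_periodic_points[OF p(2,4,3)] .
    with p(1) show ?thesis
      by (auto simp: dist_commute)
  qed
  then show ?thesis
    by (auto simp: closure_approachable)
qed

text \<open>
  Periodic points serve as the separated pair because only they can be reversed as a whole. The
  constant \<open>\<delta>\<close> of the shift is halved twice: once to pass from \<^const>\<open>seq_dist\<close> to
  a coordinate, and once to pass from two orbits that are far apart to one that is far from \<open>xs\<close>.
\<close>

lemma sv_sensitive_if_shift_sensitive: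
  fixes F :: "'a::metric_space \<Rightarrow> 'a set"
  assumes cpt: "compact (UNIV :: 'a set)" and surj: "(\<Union>x. F x) = UNIV"
    and dense: "Metric_space.mtopology (inverse_limit F) seq_dist closure_of
      Metric_space.periodic_points (inverse_limit F) shift = inverse_limit F"
    and sens: "Metric_space.sensitive_map (inverse_limit F) seq_dist shift"
  shows "sv_sensitive F"
proof -
  let ?L = "inverse_limit F"
  interpret Metric_space ?L seq_dist
    by (rule Metric_space_seq_dist[OF cpt])
  obtain \<delta> where "\<delta> > 0" and \<delta>: "\<And>x \<epsilon>. x \<in> ?L \<Longrightarrow> \<epsilon> > 0 \<Longrightarrow>
      \<exists>y\<in>?L. seq_dist x y < \<epsilon> \<and> (\<exists>n\<ge>1. seq_dist ((shift ^^ n) x) ((shift ^^ n) y) > \<delta>)"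
    using sens unfolding sensitive_map_def by auto
  have "\<exists>y\<in>ball x \<epsilon>. \<exists>ys. is_orbit F y ys \<and> (\<exists>n\<ge>1. dist (xs n) (ys n) > \<delta> / 4)"
    if "\<epsilon> > 0" for \<epsilon> x xs
  proof -
    obtain u where "u \<in> ?L" "u 0 = x"
      using inverse_limit_through_point[OF surj] .
    with \<open>\<epsilon> > 0\<close> have "{z \<in> ?L. z 0 \<in> ball x (\<epsilon> / 2)} \<noteq> {}"
      by auto
    then obtain z m where z: "z \<in> {z \<in> ?L. z 0 \<in> ball x (\<epsilon> / 2)}"
      and zL: "z \<in> ?L" and "m \<ge> 1" and zm: "\<And>i. z (i + m) = z i"
      using periodic_point_in_open[OF cpt dense openin_cylinder[OF cpt open_ball]] by blast
    obtain v n where v: "v \<in> ?L" "seq_dist z v < \<epsilon> / 2" "n \<ge> 1"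
      "seq_dist ((shift ^^ n) z) ((shift ^^ n) v) > \<delta>"
      using \<delta>[OF zL, of "\<epsilon> / 2"] \<open>\<epsilon> > 0\<close> by auto
    obtain j where j: "dist (((shift ^^ n) z) j) (((shift ^^ n) v) j) > \<delta> / 2"
      using seq_dist_gt_imp_coordinate_gt[OF cpt v(4)] .
    define k where "k = j + n"
    have "k \<ge> 1" and k: "dist (z k) (v k) > \<delta> / 2"
      using v(3) j by (simp_all add: k_def shift_funpow)
    \<comment> \<open>\<open>v\<close> need not be periodic, but what matters about it holds on a neighbourhood of it.\<close>
    define W where
      "W = {w \<in> ?L. w 0 \<in> ball (z 0) (\<epsilon> / 2)} \<inter> {w \<in> ?L. w k \<in> - cball (z k) (\<delta> / 2)}"
    have "openin mtopology W"
      unfolding W_def by (intro openin_Int openin_cylinder cpt open_ball open_Compl closed_cball)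
    moreover have "v \<in> W"
      using v(1,2) k dist_coordinate_le_seq_dist[OF cpt, of z 0 v] by (simp add: W_def)
    ultimately obtain w l where w: "w \<in> W" and wL: "w \<in> ?L" and "l \<ge> 1"
      and wl: "\<And>i. w (i + l) = w i"
      using periodic_point_in_open[OF cpt dense] by (metis empty_iff)
    \<comment> \<open>The factor \<open>2\<close> keeps the common period from being \<open>1\<close>, in which case
      \<open>t\<close> would be \<open>0\<close>.\<close>
    define p where "p = 2 * (m * l)"
    define t where "t = (p - 1) * k"
    have "p \<ge> 2"
      using \<open>m \<ge> 1\<close> \<open>l \<ge> 1\<close> by (simp add: p_def)
    then have "t \<ge> 1"
      using \<open>k \<ge> 1\<close> by (simp add: t_def Suc_le_eq)
    have zp: "z (i + p) = z i" for i
      using add_mult_period[of z m i "2 * l", OF zm] by (simp add: p_def mult_ac)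
    have wp: "w (i + p) = w i" for i
      using add_mult_period[of w l i "2 * m", OF wl] by (simp add: p_def mult_ac)
    define zs where "zs i = z ((p - 1) * i)" for i
    define ws where "ws i = w ((p - 1) * i)" for i
    have orbits: "is_orbit F (z 0) zs" "is_orbit F (w 0) ws"
      unfolding zs_def ws_def using \<open>p \<ge> 2\<close>
      by (intro is_orbit_reverse_periodic zL wL zp wp; simp)+
    have near: "z 0 \<in> ball x \<epsilon>" "w 0 \<in> ball x \<epsilon>"
      using z w \<open>\<epsilon> > 0\<close> dist_triangle[of x "w 0" "z 0"] by (auto simp: W_def)
    have "zs t = z k" "ws t = w k"
      unfolding zs_def ws_def t_def
      using reverse_periodic_at[of z p, OF zp \<open>p \<ge> 2\<close>]
        reverse_periodic_at[of w p, OF wp \<open>p \<ge> 2\<close>] by auto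
    then have "dist (zs t) (ws t) > \<delta> / 2"
      using w by (simp add: W_def not_le)
    then have "dist (xs t) (zs t) > \<delta> / 4 \<or> dist (xs t) (ws t) > \<delta> / 4"
      using dist_triangle3[of "zs t" "ws t" "xs t"] by linarith
    with orbits near \<open>t \<ge> 1\<close> show ?thesis
      by blast
  qed
  with \<open>\<delta> > 0\<close> show ?thesis
    unfolding sv_sensitive_def by (intro exI[of _ "\<delta> / 4"]) auto
qed

theorem theorem5p6:
  fixes F :: "'a::metric_space \<Rightarrow> 'a set"
  assumes "compact (UNIV :: 'a set)"
    and "diameter (UNIV :: 'a set) = 1"
    and "closed_valued F"
    and "upper_semicontinuous F"
    and "(\<Union>x. F x) = UNIV"
    and "Metric_space.devaney_chaotic_map (inverse_limit F) seq_dist shift"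
  shows "sv_devaney_chaotic F"
proof -
  interpret Metric_space "inverse_limit F" seq_dist
    by (rule Metric_space_seq_dist[OF assms(1)])
  have chaos: "transitive_map shift"
    "mtopology closure_of periodic_points shift = inverse_limit F" "sensitive_map shift"
    using assms(6) by (auto simp: devaney_chaotic_map_def)
  have ne: "F x \<noteq> {}" for x
    using assms(3) by (simp add: closed_valued_def)
  show ?thesis
    unfolding sv_devaney_chaotic_def
    using sv_transitive_if_shift_transitive[OF assms(1) ne assms(5) chaos(1)]
      closure_sv_periodic_points_if_shift_periodic_dense[OF assms(1,5) chaos(2)]
      sv_sensitive_if_shift_sensitive[OF assms(1,5) chaos(2,3)]
    by blast
qed

end
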